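(* Let $(\mu_t,R_t,d_t)$ be a one-parameter formal deformation of a Reynolds LieDer pair $(L,\mu,R,d)$, with $\mu_t=\sum_{i\ge0}\mu_it^i$, $R_t=\sum_{i\ge0}R_it^i$, $d_t=\sum_{i\ge0}d_it^i$. Then $(\mu_1,R_1,d_1)$ is a $2$-cocycle in the cochain complex $\big(\oplus_n\mathfrak{C}^n_{\mathrm{RLieDer}}(L,L),\mathfrak{D}_{\mathrm{RLieDer}}\big)$, i.e. $\mathfrak{D}_{\mathrm{RLieDer}}(\mu_1,R_1,d_1)=0$.
   Context: All vector spaces are over a ground field $K$. A Reynolds LieDer pair $(L,\mu,R,d)$ is a Lie algebra $L$ with bracket $\mu=[-,-]$, a linear map $R:L\to L$ (Reynolds operator) with $[Rx,Ry]=R([Rx,y]+[x,Ry]-[Rx,Ry])$, and a derivation $d$ of $L$ with $R\circ d=d\circ R$. A one-parameter formal deformation of $(L,\mu,R,d)$ is a triple of power series $\mu_t=\sum_{i\ge0}\mu_it^i$, $R_t=\sum_{i\ge0}R_it^i$, $d_t=\sum_{i\ge0}d_it^i$, with $\mu_i\in\mathrm{Hom}(\wedge^2L,L)$, $R_i,d_i\in\mathrm{Hom}(L,L)$, $(\mu_0,R_0,d_0)=(\mu,R,d)$, such that $(L[[t]],\mu_t,R_t,d_t)$, with maps extended $K[[t]]$-(bi)linearly, is a Reynolds LieDer pair over $K[[t]]$. Complex with coefficients in the adjoint representation. For $f\in\mathrm{Hom}(\wedge^nL,L)$, $n\ge1$: $$(\delta_{CE}f)(x_1,\dots,x_{n+1})=\sum_{i=1}^{n+1}(-1)^{i+n}[x_i,f(x_1,\dots,\hat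 x_i,\dots,x_{n+1})]+\sum_{1\le i<j\le n+1}(-1)^{i+j+n+1}f([x_i,x_j],x_1,\dots,\hat x_i,\dots,\hat x_j,\dots,x_{n+1});$$ $\delta_R$ is given by the same formula with the argument bracket $[x_i,x_j]$ replaced by $[x_i,x_j]_R$, where $[x,y]_R=[x,Ry]+[Rx,y]-[Rx,Ry]$, and the action $[x_i,-]$ replaced by $\rho_R(x_i)$, where $\rho_R(x)u=[Rx,u]+R([Rx,u]-[x,u])$; $$(\varphi f)(x_1,\dots,x_n)=f(Rx_1,\dots,Rx_n)-R\sum_{i=1}^nf(Rx_1,\dots,Rx_{i-1},x_i,Rx_{i+1},\dots,Rx_n)+(n-1)Rf(Rx_1,\dots,Rx_n);$$ $$(\Delta f)(x_1,\dots,x_n)=\sum_{i=1}^nf(x_1,\dots,dx_i,\dots,x_n)-d(f(x_1,\dots,x_n)).$$ Put $C^1_R(L,L)=\mathrm{Hom}(L,L)$ and $C^n_R(L,L)=\mathrm{Hom}(\wedge^nL,L)\oplus\mathrm{Hom}(\wedge^{n-1}L,L)$ for $n\ge2$; $D_R(f)=(\delta_{CE}f,-\varphi f)$ for $n=1$, $D_R(f,g)=(\delta_{CE}f,-\delta_Rg-\varphi f)$ for $n\ge2$; $\Delta(f,g)=(\Delta f,\Delta g)$. Then $\mathfrak{C}^1_{\mathrm{RLieDer}}=C^1_R$, $\mathfrak{C}^n_{\mathrm{RLieDer}}=C^n_R\times C^{n-1}_R$ for $n\ge2$, $\mathfrak{D}_{\mathrm{RLieDer}}(f)=(D_Rf,-\Delta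 f)$ on degree $1$, and $\mathfrak{D}_{\mathrm{RLieDer}}(F,\tilde F)=(D_RF,\,D_R\tilde F+(-1)^n\Delta F)$ on degree $n\ge2$. A $2$-cochain is thus a triple $(\mu_1,R_1,d_1)=((\mu_1,R_1),d_1)$ with $\mu_1\in\mathrm{Hom}(\wedge^2L,L)$, $R_1,d_1\in\mathrm{Hom}(L,L)$. *)

theory Defs
  imports
    "HOL-Computational_Algebra.Formal_Power_Series"
    "HOL-Library.Function_Algebras"
    "HOL-Library.Product_Plus"
begin

section \<open>Reynolds LieDer pairs\<close>

text \<open>The underlying module is a whole type, with a scalar multiplication \<open>scale\<close> as in the
  library locale \<^locale>\<open>module\<close>. The ground ring is an arbitrary commutative ring, so that the
  same notion serves for L over K and for L[[t]] over K[[t]].\<close>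

definition alternating_bilinear ::
  "('k::comm_ring_1 \<Rightarrow> 'a::ab_group_add \<Rightarrow> 'a) \<Rightarrow> ('a \<Rightarrow> 'a \<Rightarrow> 'a) \<Rightarrow> bool" where
  "alternating_bilinear scale \<beta> \<longleftrightarrow>
     (\<forall>x. module_hom scale scale (\<beta> x)) \<and>
     (\<forall>y. module_hom scale scale (\<lambda>x. \<beta> x y)) \<and>
     (\<forall>x. \<beta> x x = 0)"

locale lie_algebra = module scale
  for scale :: "'k::comm_ring_1 \<Rightarrow> 'a::ab_group_add \<Rightarrow> 'a" +
  fixes br :: "'a \<Rightarrow> 'a \<Rightarrow> 'a"
  assumes br_alternating_bilinear: "alternating_bilinear scale br"
    and jacobi: "br x (br y z) + br y (br z x) + br z (br x y) = 0"

locale reynolds_LieDer_pair = lie_algebra scale br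
  for scale :: "'k::comm_ring_1 \<Rightarrow> 'a::ab_group_add \<Rightarrow> 'a" and br :: "'a \<Rightarrow> 'a \<Rightarrow> 'a" +
  fixes R d :: "'a \<Rightarrow> 'a"
  assumes R_linear: "module_hom scale scale R"
    and reynolds: "br (R x) (R y) = R (br (R x) y + br x (R y) - br (R x) (R y))"
    and d_linear: "module_hom scale scale d"
    and derivation: "d (br x y) = br (d x) y + br x (d y)"
    and R_d_commute: "R \<circ> d = d \<circ> R"

section \<open>Formal deformations\<close>

text \<open>L[[t]] is the type \<^typ>\<open>'a fps\<close>; its K[[t]]-module structure and the K[[t]]-(bi)linear
  extensions of power series of (bi)linear maps are given by convolution.\<close>

definition fps_scale ::
  "('k::comm_ring_1 \<Rightarrow> 'a::ab_group_add \<Rightarrow> 'a) \<Rightarrow> 'k fps \<Rightarrow> 'a fps \<Rightarrow> 'a fps" where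
  "fps_scale scale c v = Abs_fps (\<lambda>n. \<Sum>i=0..n. scale (fps_nth c i) (fps_nth v (n - i)))"

definition fps_linear_ext :: "(nat \<Rightarrow> 'a::ab_group_add \<Rightarrow> 'a) \<Rightarrow> 'a fps \<Rightarrow> 'a fps" where
  "fps_linear_ext F v = Abs_fps (\<lambda>n. \<Sum>i=0..n. F i (fps_nth v (n - i)))"

definition fps_bilinear_ext ::
  "(nat \<Rightarrow> 'a::ab_group_add \<Rightarrow> 'a \<Rightarrow> 'a) \<Rightarrow> 'a fps \<Rightarrow> 'a fps \<Rightarrow> 'a fps" where
  "fps_bilinear_ext B u v = Abs_fps (\<lambda>n. \<Sum>i=0..n. \<Sum>j=0..n - i.
     B i (fps_nth u j) (fps_nth v (n - i - j)))"

lemma module_fps_scale: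
  assumes "module scale"
  shows "module (fps_scale scale)"
proof -
  interpret module scale by fact
  show ?thesis
  proof
    fix a b :: "'a fps" and x y :: "'b fps"
    show "fps_scale scale a (x + y) = fps_scale scale a x + fps_scale scale a y"
      by (simp add: fps_scale_def fps_eq_iff scale_right_distrib sum.distrib)
    show "fps_scale scale (a + b) x = fps_scale scale a x + fps_scale scale b x"
      by (simp add: fps_scale_def fps_eq_iff scale_left_distrib sum.distrib)
    show "fps_scale scale 1 x = x"
    proof (rule fps_ext)
      fix n
      have "(\<Sum>i=0..n. scale (fps_nth 1 i) (fps_nth x (n - i))) =
            (\<Sum>i=0..n. if i = 0 then fps_nth x n else 0)"
        by (rule sum.cong) auto
      then show "fps_nth (fps_scale scale 1 x) n = fps_nth x n"
        by (simp add: fps_scale_def)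
    qed
    show "fps_scale scale a (fps_scale scale b x) = fps_scale scale (a * b) x"
    proof (rule fps_ext)
      fix n
      have "(\<Sum>j=0..n. \<Sum>i=0..j. scale (fps_nth a i * fps_nth b (j - i)) (fps_nth x (n - j))) =
            (\<Sum>j=0..n. \<Sum>i=0..n - j. scale (fps_nth a j * fps_nth b i) (fps_nth x (n - j - i)))"
        by (rule fps_mult_assoc_lemma)
      then show "fps_nth (fps_scale scale a (fps_scale scale b x)) n =
          fps_nth (fps_scale scale (a * b) x) n"
        by (simp add: fps_scale_def fps_mult_nth scale_sum_left scale_sum_right)
    qed
  qed
qed

locale formal_deformation = vector_space scale + reynolds_LieDer_pair scale br R d
  for scale :: "'k::field \<Rightarrow> 'a::ab_group_add \<Rightarrow> 'a"
    and br :: "'a \<Rightarrow> 'a \<Rightarrow> 'a" and R d :: "'a \<Rightarrow> 'a" +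
  fixes \<mu>s :: "nat \<Rightarrow> 'a \<Rightarrow> 'a \<Rightarrow> 'a" and Rs ds :: "nat \<Rightarrow> 'a \<Rightarrow> 'a"
  assumes \<mu>s_alternating_bilinear: "alternating_bilinear scale (\<mu>s i)"
    and Rs_linear: "module_hom scale scale (Rs i)"
    and ds_linear: "module_hom scale scale (ds i)"
    and \<mu>s_0: "\<mu>s 0 = br"
    and Rs_0: "Rs 0 = R"
    and ds_0: "ds 0 = d"
    and deformed_pair: "reynolds_LieDer_pair (fps_scale scale)
          (fps_bilinear_ext \<mu>s) (fps_linear_ext Rs) (fps_linear_ext ds)"

section \<open>Cochains\<close>

text \<open>An element of \<open>Hom (\<And>\<^sup>n L, L)\<close> is an alternating multilinear map on argument
  lists of length n, extended by 0 to lists of any other length, so that cochains are equal iff they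
  are equal as functions.\<close>

type_synonym 'a cochain = "'a list \<Rightarrow> 'a"

definition alt_Hom ::
  "('k::comm_ring_1 \<Rightarrow> 'a::ab_group_add \<Rightarrow> 'a) \<Rightarrow> nat \<Rightarrow> 'a cochain set" where
  "alt_Hom scale n = {f.
     (\<forall>xs. length xs \<noteq> n \<longrightarrow> f xs = 0) \<and>
     (\<forall>xs i. length xs = n \<and> i < n \<longrightarrow> module_hom scale scale (\<lambda>x. f (xs[i := x]))) \<and>
     (\<forall>xs i j. length xs = n \<and> i < j \<and> j < n \<and> xs ! i = xs ! j \<longrightarrow> f xs = 0)}"

definition cochain1 :: "('a::zero \<Rightarrow> 'a) \<Rightarrow> 'a cochain" where
  "cochain1 f xs = (case xs of [x] \<Rightarrow> f x | _ \<Rightarrow> 0)"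

definition cochain2 :: "('a::zero \<Rightarrow> 'a \<Rightarrow> 'a) \<Rightarrow> 'a cochain" where
  "cochain2 \<beta> xs = (case xs of [x, y] \<Rightarrow> \<beta> x y | _ \<Rightarrow> 0)"

text \<open>Argument positions are counted from 1 in \<open>arg\<close> and \<open>omit\<close>.\<close>

definition arg :: "'a list \<Rightarrow> nat \<Rightarrow> 'a" where
  "arg xs i = xs ! (i - 1)"

definition omit :: "nat set \<Rightarrow> 'a list \<Rightarrow> 'a list" where
  "omit I xs = nths xs {k. Suc k \<notin> I}"

text \<open>The Chevalley--Eilenberg formula for an action \<open>\<rho>\<close> and a bracket on the arguments, in
  degree n.\<close>

definition CE_diff ::
  "('k::comm_ring_1 \<Rightarrow> 'a::ab_group_add \<Rightarrow> 'a) \<Rightarrow> ('a \<Rightarrow> 'a \<Rightarrow> 'a) \<Rightarrow> ('a \<Rightarrow> 'a \<Rightarrow> 'a) \<Rightarrow>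
   nat \<Rightarrow> 'a cochain \<Rightarrow> 'a cochain" where
  "CE_diff scale \<rho> br n f xs = (if length xs \<noteq> n + 1 then 0 else
     (\<Sum>i=1..n+1. scale ((-1) ^ (i + n)) (\<rho> (arg xs i) (f (omit {i} xs)))) +
     (\<Sum>i=1..n+1. \<Sum>j=i+1..n+1.
        scale ((-1) ^ (i + j + n + 1)) (f (br (arg xs i) (arg xs j) # omit {i, j} xs))))"

definition bracket_R :: "('a::ab_group_add \<Rightarrow> 'a \<Rightarrow> 'a) \<Rightarrow> ('a \<Rightarrow> 'a) \<Rightarrow> 'a \<Rightarrow> 'a \<Rightarrow> 'a" where
  "bracket_R br R x y = br x (R y) + br (R x) y - br (R x) (R y)"

definition action_R :: "('a::ab_group_add \<Rightarrow> 'a \<Rightarrow> 'a) \<Rightarrow> ('a \<Rightarrow> 'a) \<Rightarrow> 'a \<Rightarrow> 'a \<Rightarrow> 'a" where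
  "action_R br R x u = br (R x) u + R (br (R x) u - br x u)"

definition delta_CE ::
  "('k::comm_ring_1 \<Rightarrow> 'a::ab_group_add \<Rightarrow> 'a) \<Rightarrow> ('a \<Rightarrow> 'a \<Rightarrow> 'a) \<Rightarrow>
   nat \<Rightarrow> 'a cochain \<Rightarrow> 'a cochain" where
  "delta_CE scale br = CE_diff scale br br"

definition delta_R ::
  "('k::comm_ring_1 \<Rightarrow> 'a::ab_group_add \<Rightarrow> 'a) \<Rightarrow> ('a \<Rightarrow> 'a \<Rightarrow> 'a) \<Rightarrow> ('a \<Rightarrow> 'a) \<Rightarrow>
   nat \<Rightarrow> 'a cochain \<Rightarrow> 'a cochain" where
  "delta_R scale br R = CE_diff scale (action_R br R) (bracket_R br R)"

definition phi ::
  "('k::comm_ring_1 \<Rightarrow> 'a::ab_group_add \<Rightarrow> 'a) \<Rightarrow> ('a \<Rightarrow> 'a) \<Rightarrow>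
   nat \<Rightarrow> 'a cochain \<Rightarrow> 'a cochain" where
  "phi scale R n f xs = (if length xs \<noteq> n then 0 else
     f (map R xs) - R (\<Sum>i=1..n. f ((map R xs)[i - 1 := arg xs i])) +
     scale (of_nat (n - 1)) (R (f (map R xs))))"

definition Delta :: "('a::ab_group_add \<Rightarrow> 'a) \<Rightarrow> nat \<Rightarrow> 'a cochain \<Rightarrow> 'a cochain" where
  "Delta d n f xs = (if length xs \<noteq> n then 0 else
     (\<Sum>i=1..n. f (xs[i - 1 := d (arg xs i)])) - d (f xs))"

section \<open>The cochain complex of a Reynolds LieDer pair\<close>

text \<open>Degree n (with n at least 1) is uniformly encoded by pairs, and pairs of pairs; the component
  that does not exist in degree 1 is set to 0.\<close>

type_synonym 'a R_cochain = "'a cochain \<times> 'a cochain"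
type_synonym 'a RLieDer_cochain = "'a R_cochain \<times> 'a R_cochain"

definition C_R ::
  "('k::comm_ring_1 \<Rightarrow> 'a::ab_group_add \<Rightarrow> 'a) \<Rightarrow> nat \<Rightarrow> 'a R_cochain set" where
  "C_R scale n =
     (if n = 1 then alt_Hom scale 1 \<times> {0} else alt_Hom scale n \<times> alt_Hom scale (n - 1))"

definition D_R ::
  "('k::comm_ring_1 \<Rightarrow> 'a::ab_group_add \<Rightarrow> 'a) \<Rightarrow> ('a \<Rightarrow> 'a \<Rightarrow> 'a) \<Rightarrow> ('a \<Rightarrow> 'a) \<Rightarrow>
   nat \<Rightarrow> 'a R_cochain \<Rightarrow> 'a R_cochain" where
  "D_R scale br R n = (\<lambda>(f, g).
     if n = 1 then (delta_CE scale br 1 f, - phi scale R 1 f)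
     else (delta_CE scale br n f, - delta_R scale br R (n - 1) g - phi scale R n f))"

definition Delta_R :: "('a::ab_group_add \<Rightarrow> 'a) \<Rightarrow> nat \<Rightarrow> 'a R_cochain \<Rightarrow> 'a R_cochain" where
  "Delta_R d n = (\<lambda>(f, g). if n = 1 then (Delta d 1 f, 0) else (Delta d n f, Delta d (n - 1) g))"

definition scale_R_cochain ::
  "('k::comm_ring_1 \<Rightarrow> 'a::ab_group_add \<Rightarrow> 'a) \<Rightarrow> 'k \<Rightarrow> 'a R_cochain \<Rightarrow> 'a R_cochain" where
  "scale_R_cochain scale c = (\<lambda>(f, g). (\<lambda>xs. scale c (f xs), \<lambda>xs. scale c (g xs)))"

definition C_RLieDer ::
  "('k::comm_ring_1 \<Rightarrow> 'a::ab_group_add \<Rightarrow> 'a) \<Rightarrow> nat \<Rightarrow> 'a RLieDer_cochain set" where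
  "C_RLieDer scale n =
     (if n = 1 then C_R scale 1 \<times> {0} else C_R scale n \<times> C_R scale (n - 1))"

definition D_RLieDer ::
  "('k::comm_ring_1 \<Rightarrow> 'a::ab_group_add \<Rightarrow> 'a) \<Rightarrow> ('a \<Rightarrow> 'a \<Rightarrow> 'a) \<Rightarrow> ('a \<Rightarrow> 'a) \<Rightarrow> ('a \<Rightarrow> 'a) \<Rightarrow>
   nat \<Rightarrow> 'a RLieDer_cochain \<Rightarrow> 'a RLieDer_cochain" where
  "D_RLieDer scale br R d n = (\<lambda>(F, G).
     if n = 1 then (D_R scale br R 1 F, - Delta_R d 1 F)
     else (D_R scale br R n F,
           D_R scale br R (n - 1) G + scale_R_cochain scale ((-1) ^ n) (Delta_R d n F)))"

definition RLieDer_cocycles ::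
  "('k::comm_ring_1 \<Rightarrow> 'a::ab_group_add \<Rightarrow> 'a) \<Rightarrow> ('a \<Rightarrow> 'a \<Rightarrow> 'a) \<Rightarrow> ('a \<Rightarrow> 'a) \<Rightarrow> ('a \<Rightarrow> 'a) \<Rightarrow>
   nat \<Rightarrow> 'a RLieDer_cochain set" where
  "RLieDer_cocycles scale br R d n = {c \<in> C_RLieDer scale n. D_RLieDer scale br R d n c = 0}"

definition two_cochain ::
  "('a::ab_group_add \<Rightarrow> 'a \<Rightarrow> 'a) \<Rightarrow> ('a \<Rightarrow> 'a) \<Rightarrow> ('a \<Rightarrow> 'a) \<Rightarrow> 'a RLieDer_cochain" where
  "two_cochain \<mu> R d = ((cochain2 \<mu>, cochain1 R), (cochain1 d, 0))"

end

theory Submission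
  imports Defs
begin

text \<open>The axioms of a Reynolds LieDer pair are identities between multilinear expressions in the
  bracket, the Reynolds operator and the derivation. Evaluating the deformed axioms on constant
  power series and comparing the coefficients of \<open>t\<close> therefore linearises them at \<open>(\<mu>, R, d)\<close>, by
  the product rule. The four linearised axioms are, up to sign, the four components of the
  cocycle condition:
  \<^item> the Jacobi identity gives the Chevalley--Eilenberg differential of \<open>\<mu>\<^sub>1\<close>;
  \<^item> the Reynolds identity gives \<open>- \<delta>\<^sub>R R\<^sub>1 - \<phi> \<mu>\<^sub>1\<close>;
  \<^item> the Leibniz rule gives \<open>\<delta>\<^sub>C\<^sub>E d\<^sub>1 + \<Delta> \<mu>\<^sub>1\<close>;
  \<^item> the commutation of \<open>R\<close> with \<open>d\<close> gives \<open>- \<phi> d\<^sub>1 + \<Delta> R\<^sub>1\<close>.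

  The matching uses only additivity and the skew-symmetry of \<open>\<mu>\<close> and \<open>\<mu>\<^sub>1\<close>.\<close>

section \<open>Bilinear maps and low-degree cochains\<close>

lemma alternating_bilinear_simps:
  assumes "alternating_bilinear scale \<beta>"
  shows "\<beta> x (y + z) = \<beta> x y + \<beta> x z" "\<beta> (x + y) z = \<beta> x z + \<beta> y z"
    "\<beta> x (y - z) = \<beta> x y - \<beta> x z" "\<beta> (x - y) z = \<beta> x z - \<beta> y z"
    "\<beta> x (- y) = - \<beta> x y" "\<beta> (- x) y = - \<beta> x y"
    "\<beta> x 0 = 0" "\<beta> 0 x = 0" "\<beta> x x = 0"
  using assms
  by (simp_all add: alternating_bilinear_def module_hom.add[of scale scale "\<beta> _"]
      module_hom.add[of scale scale "\<lambda>x. \<beta> x _"] module_hom.diff[of scale scale "\<beta> _"]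
      module_hom.diff[of scale scale "\<lambda>x. \<beta> x _"] module_hom.neg[of scale scale "\<beta> _"]
      module_hom.neg[of scale scale "\<lambda>x. \<beta> x _"] module_hom.zero[of scale scale "\<beta> _"]
      module_hom.zero[of scale scale "\<lambda>x. \<beta> x _"])

lemma alternating_bilinear_skew:
  assumes "alternating_bilinear scale \<beta>"
  shows "\<beta> x y = - \<beta> y x"
proof -
  note simps = alternating_bilinear_simps[OF assms]
  \<comment> \<open>Only additivity may be applied to this square: the alternating law would erase it.\<close>
  have "\<beta> (x + y) (x + y) = \<beta> x y + \<beta> y x"
    unfolding simps(1,2) by (simp add: simps(9))
  then have "\<beta> x y + \<beta> y x = 0"
    by (simp add: simps(9))
  then show ?thesis
    by (simp add: eq_neg_iff_add_eq_0)
qed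

lemma length_2_iff: "length xs = 2 \<longleftrightarrow> (\<exists>x y. xs = [x, y])"
  by (auto simp: numeral_2_eq_2 length_Suc_conv)

lemma length_3_iff: "length xs = 3 \<longleftrightarrow> (\<exists>x y z. xs = [x, y, z])"
  by (auto simp: numeral_3_eq_3 length_Suc_conv)

lemma cochain1_Cons [simp]: "cochain1 f [x] = f x"
  by (simp add: cochain1_def)

lemma cochain2_Cons [simp]: "cochain2 \<beta> [x, y] = \<beta> x y"
  by (simp add: cochain2_def)

lemma cochain1_in_alt_Hom:
  assumes "module_hom scale scale f"
  shows "cochain1 f \<in> alt_Hom scale 1"
  using assms by (auto simp: alt_Hom_def cochain1_def length_Suc_conv split: list.splits)

lemma cochain2_in_alt_Hom:
  assumes "alternating_bilinear scale \<beta>"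
  shows "cochain2 \<beta> \<in> alt_Hom scale 2"
  using assms
  by (auto simp: alt_Hom_def cochain2_def alternating_bilinear_def length_2_iff less_2_cases_iff
      split: list.splits)

section \<open>The differentials in low degrees\<close>

context module
begin

text \<open>The action and the argument bracket stay arbitrary, so that these expansions serve the
  Chevalley--Eilenberg differential and its twist by \<open>R\<close> alike.\<close>

lemma CE_diff_1:
  "CE_diff scale \<rho> \<beta> 1 f xs =
     (case xs of [x, y] \<Rightarrow> \<rho> x (f [y]) - \<rho> y (f [x]) - f [\<beta> x y] | _ \<Rightarrow> 0)"
proof (cases "length xs = 2")
  case True
  then obtain x y where "xs = [x, y]"
    by (auto simp: length_2_iff)
  then show ?thesis
    by (simp add: CE_diff_def arg_def omit_def nths_Cons numeral_2_eq_2)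
next
  case False
  then show ?thesis
    by (auto simp: CE_diff_def split: list.splits)
qed

lemma CE_diff_2:
  "CE_diff scale \<rho> \<beta> 2 f xs =
     (case xs of [x, y, z] \<Rightarrow>
        - \<rho> x (f [y, z]) + \<rho> y (f [x, z]) - \<rho> z (f [x, y])
        + f [\<beta> x y, z] - f [\<beta> x z, y] + f [\<beta> y z, x] | _ \<Rightarrow> 0)"
proof (cases "length xs = 3")
  case True
  then obtain x y z where "xs = [x, y, z]"
    by (auto simp: length_3_iff)
  then show ?thesis
    by (simp add: CE_diff_def arg_def omit_def nths_Cons numeral_2_eq_2 numeral_3_eq_3)
next
  case False
  then show ?thesis
    by (auto simp: CE_diff_def split: list.splits)
qed

lemma phi_1:
  "phi scale R 1 f xs = (case xs of [x] \<Rightarrow> f [R x] - R (f [x]) | _ \<Rightarrow> 0)"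
  by (auto simp: phi_def arg_def split: list.splits)

lemma phi_2:
  "phi scale R 2 f xs =
     (case xs of [x, y] \<Rightarrow>
        f [R x, R y] - R (f [x, R y] + f [R x, y]) + R (f [R x, R y]) | _ \<Rightarrow> 0)"
  by (auto simp: phi_def arg_def numeral_2_eq_2 split: list.splits)

end

lemma Delta_1:
  "Delta d 1 f xs = (case xs of [x] \<Rightarrow> f [d x] - d (f [x]) | _ \<Rightarrow> 0)"
  by (auto simp: Delta_def arg_def split: list.splits)

lemma Delta_2:
  "Delta d 2 f xs =
     (case xs of [x, y] \<Rightarrow> f [d x, y] + f [x, d y] - d (f [x, y]) | _ \<Rightarrow> 0)"
  by (auto simp: Delta_def arg_def numeral_2_eq_2 split: list.splits)

section \<open>Coefficients of the extended maps\<close>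

text \<open>In a deformed axiom the extensions are nested, so an argument need not be constant even when
  the innermost ones are. The coefficients are therefore computed for arbitrary power series; the
  coefficient of \<open>t\<close> is the product rule.\<close>

lemma fps_linear_ext_nth_0: "fps_nth (fps_linear_ext F v) 0 = F 0 (fps_nth v 0)"
  by (simp add: fps_linear_ext_def)

lemma fps_linear_ext_nth_1:
  "fps_nth (fps_linear_ext F v) 1 = F 0 (fps_nth v 1) + F 1 (fps_nth v 0)"
  by (simp add: fps_linear_ext_def)

lemma fps_bilinear_ext_nth_0:
  "fps_nth (fps_bilinear_ext B u v) 0 = B 0 (fps_nth u 0) (fps_nth v 0)"
  by (simp add: fps_bilinear_ext_def)

lemma fps_bilinear_ext_nth_1:
  "fps_nth (fps_bilinear_ext B u v) 1 =
     B 0 (fps_nth u 0) (fps_nth v 1) + B 0 (fps_nth u 1) (fps_nth v 0)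
     + B 1 (fps_nth u 0) (fps_nth v 0)"
  by (simp add: fps_bilinear_ext_def)

lemmas ext_nth = fps_linear_ext_nth_0 fps_linear_ext_nth_1
  fps_bilinear_ext_nth_0 fps_bilinear_ext_nth_1

section \<open>The deformation equations of first order\<close>

context formal_deformation
begin

lemma Rs_simps:
  "Rs i (x + y) = Rs i x + Rs i y" "Rs i (x - y) = Rs i x - Rs i y" "Rs i (- x) = - Rs i x"
  "Rs i 0 = 0"
  using Rs_linear[of i] by (simp_all add: module_hom.add module_hom.diff module_hom.neg
      module_hom.zero)

lemma ds_simps:
  "ds i (x + y) = ds i x + ds i y" "ds i (x - y) = ds i x - ds i y" "ds i (- x) = - ds i x"
  "ds i 0 = 0"
  using ds_linear[of i] by (simp_all add: module_hom.add module_hom.diff module_hom.neg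
      module_hom.zero)

lemmas \<mu>s_simps = alternating_bilinear_simps[OF \<mu>s_alternating_bilinear]
lemmas br_simps = alternating_bilinear_simps[OF br_alternating_bilinear]
lemmas R_simps = Rs_simps[of 0, unfolded Rs_0]
lemmas d_simps = ds_simps[of 0, unfolded ds_0]

text \<open>Each of the next four equations is the coefficient of \<open>t\<close> in a deformed axiom at constant power
  series: every summand contains exactly one of \<open>\<mu>\<^sub>1\<close>, \<open>R\<^sub>1\<close>, \<open>d\<^sub>1\<close>, and undeformed maps in all other
  places.\<close>

lemma first_order_jacobi:
  "br x (\<mu>s 1 y z) + br y (\<mu>s 1 z x) + br z (\<mu>s 1 x y)
   + \<mu>s 1 x (br y z) + \<mu>s 1 y (br z x) + \<mu>s 1 z (br x y) = 0"
proof -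
  interpret P: reynolds_LieDer_pair "fps_scale scale" "fps_bilinear_ext \<mu>s"
    "fps_linear_ext Rs" "fps_linear_ext ds"
    by (rule deformed_pair)
  show ?thesis
    using arg_cong[OF P.jacobi[of "fps_const x" "fps_const y" "fps_const z"],
        of "\<lambda>v. fps_nth v 1"]
    by (simp add: ext_nth[unfolded One_nat_def] \<mu>s_0 br_simps \<mu>s_simps add_ac)
qed

lemma first_order_reynolds:
  "\<mu>s 1 (R x) (R y) + br (Rs 1 x) (R y) + br (R x) (Rs 1 y) =
   Rs 1 (br (R x) y + br x (R y) - br (R x) (R y))
   + R (\<mu>s 1 (R x) y + br (Rs 1 x) y + \<mu>s 1 x (R y) + br x (Rs 1 y)
        - \<mu>s 1 (R x) (R y) - br (Rs 1 x) (R y) - br (R x) (Rs 1 y))"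
proof -
  interpret P: reynolds_LieDer_pair "fps_scale scale" "fps_bilinear_ext \<mu>s"
    "fps_linear_ext Rs" "fps_linear_ext ds"
    by (rule deformed_pair)
  show ?thesis
    using arg_cong[OF P.reynolds[of "fps_const x" "fps_const y"], of "\<lambda>v. fps_nth v 1"]
    by (simp add: ext_nth[unfolded One_nat_def] \<mu>s_0 Rs_0 br_simps \<mu>s_simps R_simps Rs_simps
        algebra_simps)
qed

lemma first_order_derivation:
  "d (\<mu>s 1 x y) + ds 1 (br x y) =
   \<mu>s 1 (d x) y + br (ds 1 x) y + \<mu>s 1 x (d y) + br x (ds 1 y)"
proof -
  interpret P: reynolds_LieDer_pair "fps_scale scale" "fps_bilinear_ext \<mu>s"
    "fps_linear_ext Rs" "fps_linear_ext ds"
    by (rule deformed_pair)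
  show ?thesis
    using arg_cong[OF P.derivation[of "fps_const x" "fps_const y"], of "\<lambda>v. fps_nth v 1"]
    by (simp add: ext_nth[unfolded One_nat_def] \<mu>s_0 ds_0 br_simps \<mu>s_simps d_simps ds_simps
        algebra_simps)
qed

lemma first_order_commute: "R (ds 1 x) + Rs 1 (d x) = d (Rs 1 x) + ds 1 (R x)"
proof -
  interpret P: reynolds_LieDer_pair "fps_scale scale" "fps_bilinear_ext \<mu>s"
    "fps_linear_ext Rs" "fps_linear_ext ds"
    by (rule deformed_pair)
  show ?thesis
    using arg_cong[OF fun_cong[OF P.R_d_commute, of "fps_const x"], of "\<lambda>v. fps_nth v 1"]
    by (simp add: ext_nth[unfolded One_nat_def] Rs_0 ds_0 R_simps d_simps Rs_simps ds_simps)
qed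

section \<open>The components of the cocycle condition\<close>

text \<open>The differential is the negative of the linearised Jacobi sum, in which the cyclic order of the
  arguments has to be exchanged for the increasing order by skew-symmetry of both brackets.\<close>

lemma delta_CE_infinitesimal_bracket: "delta_CE scale br 2 (cochain2 (\<mu>s 1)) = 0"
proof -
  have "- br x (\<mu>s 1 y z) + br y (\<mu>s 1 x z) - br z (\<mu>s 1 x y)
      + \<mu>s 1 (br x y) z - \<mu>s 1 (br x z) y + \<mu>s 1 (br y z) x = 0" for x y z
  proof -
    have skew: "\<mu>s 1 z x = - \<mu>s 1 x z" "br z x = - br x z"
      "\<mu>s 1 x (br y z) = - \<mu>s 1 (br y z) x" "\<mu>s 1 y (br x z) = - \<mu>s 1 (br x z) y"
      "\<mu>s 1 z (br x y) = - \<mu>s 1 (br x y) z"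
      by (rule alternating_bilinear_skew, rule \<mu>s_alternating_bilinear br_alternating_bilinear)+
    show ?thesis
      using first_order_jacobi[of x y z]
      unfolding skew br_simps \<mu>s_simps
      by (simp add: algebra_simps)
  qed
  then show ?thesis
    by (auto simp: fun_eq_iff delta_CE_def CE_diff_2 split: list.split)
qed

text \<open>In the linearised Reynolds identity, the terms with \<open>R\<^sub>1\<close> inside a bracket add up to
  \<open>\<rho>\<^sub>R(x) R\<^sub>1 y - \<rho>\<^sub>R(y) R\<^sub>1 x\<close>, the term with \<open>R\<^sub>1\<close> outside is \<open>R\<^sub>1 [x, y]\<^sub>R\<close>, and the terms with \<open>\<mu>\<^sub>1\<close>
  form \<open>\<phi> \<mu>\<^sub>1\<close>. This is the reason for the shape of the action \<open>\<rho>\<^sub>R\<close>.\<close>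

lemma delta_R_infinitesimal_operator:
  "- delta_R scale br R 1 (cochain1 (Rs 1)) - phi scale R 2 (cochain2 (\<mu>s 1)) = 0"
proof -
  have "action_R br R x (Rs 1 y) - action_R br R y (Rs 1 x) - Rs 1 (bracket_R br R x y)
      + (\<mu>s 1 (R x) (R y) - R (\<mu>s 1 x (R y) + \<mu>s 1 (R x) y) + R (\<mu>s 1 (R x) (R y))) = 0" for x y
  proof -
    have skew: "br (R y) (Rs 1 x) = - br (Rs 1 x) (R y)" "br y (Rs 1 x) = - br (Rs 1 x) y"
      by (rule alternating_bilinear_skew, rule br_alternating_bilinear)+
    show ?thesis
      using first_order_reynolds[of x y]
      unfolding action_R_def bracket_R_def skew
      by (simp add: R_simps Rs_simps algebra_simps)
  qed
  then show ?thesis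
    by (auto simp: fun_eq_iff delta_R_def CE_diff_1[unfolded One_nat_def] phi_2 algebra_simps
        split: list.split)
qed

text \<open>The linearised Leibniz rule, with \<open>[d\<^sub>1 x, y]\<close> written as \<open>- [y, d\<^sub>1 x]\<close>. The sign of
  \<open>\<Delta> \<mu>\<^sub>1\<close> is the factor \<open>(-1)\<^sup>n\<close> of the total differential at \<open>n = 2\<close>.\<close>

lemma delta_CE_infinitesimal_derivation:
  "delta_CE scale br 1 (cochain1 (ds 1)) + Delta d 2 (cochain2 (\<mu>s 1)) = 0"
proof -
  have "br x (ds 1 y) - br y (ds 1 x) - ds 1 (br x y)
      + (\<mu>s 1 (d x) y + \<mu>s 1 x (d y) - d (\<mu>s 1 x y)) = 0" for x y
    using first_order_derivation[of x y]
      alternating_bilinear_skew[OF br_alternating_bilinear, of y "ds 1 x"]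
    by (simp add: algebra_simps)
  then show ?thesis
    by (auto simp: fun_eq_iff delta_CE_def CE_diff_1[unfolded One_nat_def] Delta_2
        split: list.split)
qed

lemma phi_infinitesimal_derivation:
  "- phi scale R 1 (cochain1 (ds 1)) + Delta d 1 (cochain1 (Rs 1)) = 0"
proof -
  have "ds 1 (R x) - R (ds 1 x) = Rs 1 (d x) - d (Rs 1 x)" for x
    using first_order_commute[of x] by (simp add: algebra_simps)
  then show ?thesis
    by (auto simp: fun_eq_iff phi_1[unfolded One_nat_def] Delta_1[unfolded One_nat_def]
        split: list.split)
qed

end

section \<open>The infinitesimal is a cocycle\<close>

theorem theorem4p1:
  fixes scale :: "'k::field \<Rightarrow> 'a::ab_group_add \<Rightarrow> 'a"
    and \<mu> :: "'a \<Rightarrow> 'a \<Rightarrow> 'a" and R d :: "'a \<Rightarrow> 'a"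
    and \<mu>s :: "nat \<Rightarrow> 'a \<Rightarrow> 'a \<Rightarrow> 'a" and Rs ds :: "nat \<Rightarrow> 'a \<Rightarrow> 'a"
  assumes "vector_space scale"
    and "reynolds_LieDer_pair scale \<mu> R d"
    and "formal_deformation scale \<mu> R d \<mu>s Rs ds"
  shows "two_cochain (\<mu>s 1) (Rs 1) (ds 1) \<in> RLieDer_cocycles scale \<mu> R d 2"
proof -
  interpret formal_deformation scale \<mu> R d \<mu>s Rs ds
    by fact
  have "two_cochain (\<mu>s 1) (Rs 1) (ds 1) \<in> C_RLieDer scale 2"
    using cochain1_in_alt_Hom[OF Rs_linear] cochain1_in_alt_Hom[OF ds_linear]
      cochain2_in_alt_Hom[OF \<mu>s_alternating_bilinear]
    by (simp add: two_cochain_def C_RLieDer_def C_R_def)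
  moreover have "D_RLieDer scale \<mu> R d 2 (two_cochain (\<mu>s 1) (Rs 1) (ds 1)) = 0"
    using delta_CE_infinitesimal_bracket delta_R_infinitesimal_operator
      delta_CE_infinitesimal_derivation phi_infinitesimal_derivation
    by (simp add: two_cochain_def D_RLieDer_def D_R_def Delta_R_def scale_R_cochain_def
        zero_prod_def)
  ultimately show ?thesis
    by (simp add: RLieDer_cocycles_def)
qed

end
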